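(* For every integer $p\ge 0$, the exponential generating function of the $p$-Bernoulli numbers $B_{n,p}$ is $$\sum_{n=0}^{\infty}B_{n,p}\frac{t^{n}}{n!}=\frac{(p+1)\,(t-H_{p})\,e^{pt}}{(e^{t}-1)^{p+1}}+(p+1)\sum_{k=1}^{p}\binom{p}{k}\frac{H_{k}}{(e^{t}-1)^{k+1}}.$$
   Context: The $p$-Bernoulli numbers $B_{n,p}$ ($n\ge 0$, $p\ge 0$ integers) are the rational numbers determined by $B_{0,p}=1$ for all $p\ge 0$ and the recursion $$B_{n+1,p}=p\,B_{n,p}-\frac{(p+1)^{2}}{p+2}\,B_{n,p+1}.$$ Equivalently, $B_{n,p}=\sum_{k=0}^{n}(-1)^{k}{n\brace k}\binom{k+p+1}{k}^{-1}k!$, where ${n\brace k}$ is the Stirling number of the second kind. In particular $B_{n,0}=B_n$ is the $n$th Bernoulli number. $H_n=\sum_{j=1}^{n}\frac1j$ is the $n$th harmonic number, with $H_0=0$; empty sums are $0$. The identity is understood as an identity of formal Laurent series in $t$ over $\mathbb{Q}$. *)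

theory Defs
  imports "HOL-Computational_Algebra.Formal_Laurent_Series"
begin

primrec p_bernoulli :: "nat \<Rightarrow> nat \<Rightarrow> rat" where
  "p_bernoulli 0 p = 1"
| "p_bernoulli (Suc n) p =
     of_nat p * p_bernoulli n p - of_nat ((p + 1)\<^sup>2) / of_nat (p + 2) * p_bernoulli n (p + 1)"

(* The library's harm lives in class real_normed_field, of which rat is not an instance. *)
definition harmonic :: "nat \<Rightarrow> rat" where
  "harmonic n = (\<Sum>j = 1..n. 1 / of_nat j)"

end

(*
  Put x = e^t - 1. The series b_p(x) = sum_k (-x)^k / binomial (k+p+1, k) satisfies
  (1 + x) b_p' = p b_p - (p+1)^2/(p+2) b_(p+1), and d/dt = (1 + x) d/dx, so b_p(e^t - 1)
  obeys the recursion of the p-Bernoulli numbers and is their generating function.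
  On the other hand, with
    A_p(x) = (ln(1+x) - H_p) (1+x)^p + sum_(k <= p) binomial (p, k) H_k x^(p-k),
  both A_p and x^(p+1) b_p / (p+1) vanish at 0, equal ln(1+x) for p = 0 and satisfy
  F_(p+1)' = (p+1) F_p, hence they agree. Substituting x = e^t - 1 gives the claim.
*)
theory Submission
  imports Defs
begin

text \<open>The coefficients are \<open>(-1) ^ k / (k + p + 1 choose k)\<close>, that is
  \<open>(-1) ^ k * (p + 1) * B(k + 1, p + 1)\<close> for the Beta function \<open>B\<close>.\<close>
definition beta_fps :: "nat \<Rightarrow> rat fps" where
  "beta_fps p = Abs_fps (\<lambda>k. (-1) ^ k * (fact k * fact (p + 1) / fact (k + p + 1)))"

lemma beta_fps_nth_0 [simp]: "beta_fps p $ 0 = 1"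
  by (simp add: beta_fps_def)

text \<open>Raising \<open>k\<close> by one multiplies \<open>fact k\<close> by \<open>k + 1\<close>
  and \<open>fact (k + p + 1)\<close> by \<open>k + p + 2\<close>, and flips the sign.\<close>

lemma beta_fps_nth_Suc:
  "of_nat (k + p + 2) * beta_fps p $ Suc k = - of_nat (k + 1) * beta_fps p $ k"
proof -
  have "(fact (Suc k + p + 1) :: rat) = of_nat (k + p + 2) * fact (k + p + 1)"
    using fact_Suc[of "k + p + 1", where ?'a = rat]
    by (simp only: add_Suc add_Suc_right add_2_eq_Suc' Suc_eq_plus1[symmetric])
  then show ?thesis
    by (simp only: beta_fps_def fps_nth_Abs_fps)
      (simp add: algebra_simps del: fact_Suc of_nat_Suc of_nat_add, simp)
qed

text \<open>Raising \<open>p\<close> by one brings the factor \<open>p + 2\<close> into the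
  numerator and \<open>k + p + 2\<close> into the denominator.\<close>

lemma beta_fps_Suc_nth:
  "of_nat (k + p + 2) * beta_fps (p + 1) $ k = of_nat (p + 2) * beta_fps p $ k"
proof -
  have "(fact (k + (p + 1) + 1) :: rat) = of_nat (k + p + 2) * fact (k + p + 1)"
       "(fact (p + 1 + 1) :: rat) = of_nat (p + 2) * fact (p + 1)"
    using fact_Suc[of "k + p + 1", where ?'a = rat] fact_Suc[of "p + 1", where ?'a = rat]
    by (simp_all only: add_Suc add_Suc_right add_2_eq_Suc' Suc_eq_plus1[symmetric])
  then show ?thesis
    by (simp only: beta_fps_def fps_nth_Abs_fps) (simp del: fact_Suc of_nat_Suc of_nat_add)
qed

text \<open>For \<open>p = 0\<close> the coefficients are \<open>(-1) ^ k / (k + 1)\<close>, those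
  of the Mercator series shifted down by one.\<close>

lemma beta_fps_0: "fps_X * beta_fps 0 = fps_ln 1"
proof (rule fps_ext)
  fix n
  show "(fps_X * beta_fps 0) $ n = fps_ln 1 $ n"
    by (cases n) (simp_all add: beta_fps_def fps_ln_def divide_simps del: of_nat_Suc)
qed

text \<open>The two ratio lemmas turn every term of the \<open>n\<close>-th coefficient into a
  multiple of \<open>?b\<close>, which leaves a polynomial identity in \<open>n\<close> and
  \<open>p\<close>.\<close>

lemma beta_fps_ODE:
  "(1 + fps_X) * fps_deriv (beta_fps p) =
     of_nat p * beta_fps p - fps_const (of_nat ((p + 1)\<^sup>2) / of_nat (p + 2)) * beta_fps (p + 1)"
proof (rule fps_ext)
  fix n
  let ?b = "beta_fps p $ n" and ?N = "of_nat (n + p + 2) :: rat"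
  have nz: "?N \<noteq> 0" "(of_nat (p + 2) :: rat) \<noteq> 0"
    by (simp_all only: of_nat_eq_0_iff)
  have "((1 + fps_X) * fps_deriv (beta_fps p)) $ n = of_nat (n + 1) * beta_fps p $ Suc n + of_nat n * ?b"
    by (cases n) (simp_all add: distrib_right)
  also have "beta_fps p $ Suc n = - of_nat (n + 1) * ?b / ?N"
    unfolding beta_fps_nth_Suc[symmetric] using nz by simp
  also have "of_nat (n + 1) * (- of_nat (n + 1) * ?b / ?N) + of_nat n * ?b
      = of_nat p * ?b - of_nat ((p + 1)\<^sup>2) * ?b / ?N"
  proof -
    \<comment> \<open>Both sides equal \<open>n * p - 1\<close>.\<close>
    have "- (of_nat (n + 1))\<^sup>2 + of_nat n * ?N = of_nat p * ?N - of_nat ((p + 1)\<^sup>2)"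
      by (simp add: power2_eq_square algebra_simps)
    from arg_cong[OF this, of "\<lambda>z. z * ?b / ?N"] show ?thesis
      using nz(1) by (simp add: power2_eq_square diff_divide_distrib add_divide_distrib
          left_diff_distrib distrib_right mult.assoc del: of_nat_Suc of_nat_add of_nat_mult)
  qed
  also have "of_nat ((p + 1)\<^sup>2) * ?b / ?N
      = of_nat ((p + 1)\<^sup>2) / of_nat (p + 2) * beta_fps (p + 1) $ n"
  proof -
    have "?b = ?N * beta_fps (p + 1) $ n / of_nat (p + 2)"
      unfolding beta_fps_Suc_nth using nz by simp
    then show ?thesis
      using nz by (simp del: of_nat_Suc of_nat_add)
  qed
  finally show "((1 + fps_X) * fps_deriv (beta_fps p)) $ n =
     (of_nat p * beta_fps p - fps_const (of_nat ((p + 1)\<^sup>2) / of_nat (p + 2)) * beta_fps (p + 1)) $ n"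
    by (simp flip: fps_of_nat)
qed

text \<open>By the chain rule the inner derivative is e^t, which is also \<open>1 + fps_X\<close>
  evaluated at e^t - 1.\<close>

lemma fps_compose_exp_ODE:
  fixes f g :: "rat fps"
  assumes "(1 + fps_X) * fps_deriv f = g"
  shows "fps_deriv (f oo (fps_exp 1 - 1)) = g oo (fps_exp 1 - 1)"
  unfolding assms[symmetric]
  by (simp add: fps_compose_deriv fps_compose_mult_distrib fps_compose_add_distrib mult.commute)

lemma p_bernoulli_egf:
  "Abs_fps (\<lambda>n. p_bernoulli n p / fact n) = beta_fps p oo (fps_exp 1 - 1)"
proof (rule fps_ext, simp)
  fix n
  show "p_bernoulli n p / fact n = (beta_fps p oo (fps_exp 1 - 1)) $ n"
  \<comment> \<open>The recursion for \<open>Suc n\<close> uses the values at both \<open>p\<close>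
    and \<open>p + 1\<close>, so \<open>p\<close> stays general.\<close>
  proof (induction n arbitrary: p)
    case 0
    show ?case by simp
  next
    case (Suc n)
    have "of_nat (Suc n) * (beta_fps p oo (fps_exp 1 - 1)) $ Suc n
        = fps_deriv (beta_fps p oo (fps_exp 1 - 1)) $ n"
      by simp
    also have "\<dots> = of_nat p * (beta_fps p oo (fps_exp 1 - 1)) $ n
        - of_nat ((p + 1)\<^sup>2) / of_nat (p + 2) * (beta_fps (p + 1) oo (fps_exp 1 - 1)) $ n"
      unfolding fps_compose_exp_ODE[OF beta_fps_ODE]
      by (simp add: fps_compose_sub_distrib fps_compose_mult_distrib flip: fps_of_nat)
    also have "\<dots> = p_bernoulli (Suc n) p / fact n"
      unfolding Suc.IH[symmetric] by (simp add: diff_divide_distrib)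
    finally show ?case
      by (simp add: field_simps del: of_nat_Suc)
  qed
qed

definition harmonic_log :: "nat \<Rightarrow> rat fps" where
  "harmonic_log p = (fps_ln 1 - fps_const (harmonic p)) * (1 + fps_X) ^ p
     + (\<Sum>k\<le>p. of_nat (p choose k) * fps_const (harmonic k) * fps_X ^ (p - k))"

lemma harmonic_Suc: "harmonic (Suc p) = harmonic p + 1 / of_nat (Suc p)"
  by (simp add: harmonic_def)

text \<open>Differentiating the logarithm produces an extra (1+x)^p, and this lowers (p+1) H_(p+1)
  to (p+1) H_p. In the sum, the absorption identity for binomial coefficients extracts the factor
  p+1, and the top summand is constant.\<close>

lemma harmonic_log_deriv:
  "fps_deriv (harmonic_log (Suc p)) = of_nat (Suc p) * harmonic_log p"
proof -
  let ?L = "fps_ln 1 :: rat fps"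
  have L: "fps_deriv ?L * (1 + fps_X) = 1"
    by (simp add: fps_ln_deriv inverse_mult_eq_1)
  have c: "of_nat (Suc p) * fps_const (harmonic (Suc p)) = of_nat (Suc p) * fps_const (harmonic p) + 1"
    by (simp add: harmonic_Suc fps_of_nat [symmetric] field_simps del: of_nat_Suc)
  have "fps_deriv ((?L - fps_const (harmonic (Suc p))) * (1 + fps_X) ^ Suc p)
     = fps_deriv ?L * (1 + fps_X) * (1 + fps_X) ^ p
       + (of_nat (Suc p) * ?L - of_nat (Suc p) * fps_const (harmonic (Suc p))) * (1 + fps_X) ^ p"
    by (simp only: fps_deriv_mult fps_deriv_sub fps_deriv_const fps_deriv_power' fps_deriv_add
        fps_deriv_1 fps_deriv_fps_X diff_Suc_1) (simp add: algebra_simps del: of_nat_Suc)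
  also have "\<dots> = of_nat (Suc p) * ((?L - fps_const (harmonic p)) * (1 + fps_X) ^ p)"
    unfolding L c by (simp add: algebra_simps)
  finally have 1: "fps_deriv ((?L - fps_const (harmonic (Suc p))) * (1 + fps_X) ^ Suc p)
     = of_nat (Suc p) * ((?L - fps_const (harmonic p)) * (1 + fps_X) ^ p)" .
  have t: "fps_deriv (of_nat (Suc p choose k) * fps_const (harmonic k) * fps_X ^ (Suc p - k))
     = of_nat (Suc p) * (of_nat (p choose k) * fps_const (harmonic k) * fps_X ^ (p - k))"
    if "k \<le> p" for k
  proof -
    have "(Suc p choose k) * (Suc p - k) = Suc p * (p choose k)"
      by (metis binomial_absorb_comp diff_Suc_1 mult.commute)
    then have "of_nat (Suc p choose k) * of_nat (Suc p - k) = (of_nat (Suc p) * of_nat (p choose k) :: rat fps)"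
      by (metis of_nat_mult)
    moreover have "fps_deriv (fps_X ^ (Suc p - k)) = (of_nat (Suc p - k) * fps_X ^ (p - k) :: rat fps)"
      by (simp add: fps_deriv_power' del: of_nat_Suc)
    then have "fps_deriv (of_nat (Suc p choose k) * fps_const (harmonic k) * fps_X ^ (Suc p - k))
        = of_nat (Suc p choose k) * of_nat (Suc p - k) * (fps_const (harmonic k) * fps_X ^ (p - k))"
      by (simp flip: fps_of_nat)
    ultimately show ?thesis
      by (simp only: mult.assoc)
  qed
  have sum: "(\<Sum>k\<le>p. fps_deriv (of_nat (Suc p choose k) * fps_const (harmonic k) * fps_X ^ (Suc p - k)))
     = of_nat (Suc p) * (\<Sum>k\<le>p. of_nat (p choose k) * fps_const (harmonic k) * fps_X ^ (p - k))"
    unfolding sum_distrib_left by (rule sum.cong) (simp_all only: atMost_iff t)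
  have last: "fps_deriv (of_nat (Suc p choose Suc p) * fps_const (harmonic (Suc p))
      * fps_X ^ (Suc p - Suc p)) = 0"
    by simp
  show ?thesis
    by (simp only: harmonic_log_def sum.atMost_Suc fps_deriv_add fps_deriv_sum 1 sum last
        add_0_right distrib_left)
qed

text \<open>At \<open>n = k + (p + 1)\<close> differentiation brings down \<open>k + p + 2\<close>,
  which \<open>beta_fps_Suc_nth\<close> trades for \<open>p + 2\<close>. Below that index both
  coefficients vanish.\<close>

lemma beta_fps_deriv:
  "fps_deriv (fps_X ^ (p + 2) * beta_fps (p + 1)) = of_nat (p + 2) * (fps_X ^ (p + 1) * beta_fps p)"
proof (rule fps_ext)
  fix n
  show "fps_deriv (fps_X ^ (p + 2) * beta_fps (p + 1)) $ n
      = (of_nat (p + 2) * (fps_X ^ (p + 1) * beta_fps p)) $ n"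
  proof (cases "n < p + 1")
    case True
    then show ?thesis
      by (simp only: fps_deriv_nth fps_X_power_mult_nth fps_of_nat[symmetric] fps_mult_left_const_nth) simp
  next
    case False
    then obtain k where n: "n = k + (p + 1)"
      by (metis add.commute le_add_diff_inverse not_less)
    show ?thesis
      using beta_fps_Suc_nth[of k p] unfolding n fps_deriv_nth
      by (simp only: fps_X_power_mult_nth fps_of_nat[symmetric] fps_mult_left_const_nth) (simp add: algebra_simps)
  qed
qed

lemma beta_fps_eq_harmonic_log:
  "fps_X ^ (p + 1) * beta_fps p = of_nat (p + 1) * harmonic_log p"
proof (induction p)
  case 0
  show ?case by (simp add: beta_fps_0 harmonic_log_def harmonic_def)
next
  case (Suc p)
  let ?f = "fps_X ^ (Suc p + 1) * beta_fps (Suc p)" and ?g = "of_nat (Suc p + 1) * harmonic_log (Suc p)"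
  have "fps_deriv ?f = of_nat (p + 2) * (of_nat (p + 1) * harmonic_log p)"
    using beta_fps_deriv[of p] Suc.IH by simp
  also have "\<dots> = fps_deriv ?g"
    using harmonic_log_deriv[of p] by (simp add: algebra_simps flip: fps_of_nat)
  finally have "fps_deriv ?f = fps_deriv ?g" .
  moreover have "?f $ 0 = 0"
    by (simp add: fps_X_power_mult_nth)
  \<comment> \<open>Only the summand \<open>k = Suc p\<close> has a constant term, H_(p+1), and it
    cancels the -H_(p+1) of the logarithmic part.\<close>
  moreover have "harmonic_log (Suc p) $ 0 = 0"
    by (simp add: harmonic_log_def fps_sum_nth fps_X_power_nth Suc_diff_le fps_nth_power_0
        flip: fps_of_nat)
  then have "?g $ 0 = 0"
    by simp
  ultimately show ?case
    unfolding fps_deriv_eq_iff by simp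
qed

text \<open>Since e^t - 1 is the compositional inverse of ln(1+x), the logarithm becomes t and
  (1+x)^p becomes e^(pt).\<close>

lemma harmonic_log_compose:
  "harmonic_log p oo (fps_exp 1 - 1) = (fps_X - fps_const (harmonic p)) * fps_exp (of_nat p)
     + (\<Sum>k\<le>p. of_nat (p choose k) * fps_const (harmonic k) * (fps_exp 1 - 1) ^ (p - k))"
proof -
  have ln: "fps_ln 1 oo (fps_exp 1 - 1) = (fps_X :: rat fps)"
    by (simp add: fps_ln_fps_exp_inv fps_inv_fps_exp_compose)
  show ?thesis
    by (simp add: harmonic_log_def fps_compose_add_distrib fps_compose_sub_distrib ln
        fps_compose_mult_distrib fps_compose_sum_distrib fps_exp_power_mult
        flip: fps_compose_power fps_of_nat)
qed

lemma fps_to_fls_sum: "fps_to_fls (\<Sum>x\<in>A. f x) = (\<Sum>x\<in>A. fps_to_fls (f x))"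
  by (induction A rule: infinite_finite_induct) simp_all

theorem theorem1:
  fixes p :: nat
  shows "fps_to_fls (Abs_fps (\<lambda>n. p_bernoulli n p / fact n)) =
    of_nat (p + 1) * (fls_X - fls_const (harmonic p)) * fps_to_fls (fps_exp (of_nat p))
      / (fps_to_fls (fps_exp 1) - 1) ^ (p + 1)
    + of_nat (p + 1) * (\<Sum>k = 1..p. of_nat (p choose k) *
        (fls_const (harmonic k) / (fps_to_fls (fps_exp 1) - 1) ^ (k + 1)))"
proof -
  let ?x = "fps_exp 1 - 1 :: rat fps"
  define E where "E = fps_to_fls (fps_exp (1::rat)) - 1"
  have x: "fps_to_fls ?x = E"
    by (simp add: E_def)
  \<comment> \<open>The constant term of \<open>?x\<close> is zero, so \<open>?x\<close> is not a
    unit among power series. Being nonzero, it becomes invertible in the field of Laurent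
    series.\<close>
  have "?x $ 1 \<noteq> 0"
    by simp
  then have "?x \<noteq> 0"
    by (metis fps_zero_nth)
  then have E: "E \<noteq> 0"
    unfolding x[symmetric] by (simp only: fps_to_fls_eq_0_iff not_False_eq_True)
  \<comment> \<open>The identity is composed with e^t - 1 in product form, still among power series;
    division by \<open>E ^ (p + 1)\<close> comes only after the embedding.\<close>
  have "?x ^ (p + 1) * (beta_fps p oo ?x) = (fps_X ^ (p + 1) * beta_fps p) oo ?x"
    by (simp add: fps_compose_mult_distrib flip: fps_compose_power)
  also have "\<dots> = of_nat (p + 1) * (harmonic_log p oo ?x)"
    unfolding beta_fps_eq_harmonic_log by (simp add: fps_compose_mult_distrib flip: fps_of_nat)
  finally have "fps_to_fls (?x ^ (p + 1) * (beta_fps p oo ?x)) =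
      fps_to_fls (of_nat (p + 1) * (harmonic_log p oo ?x))"
    by (rule arg_cong)
  moreover have "fps_to_fls (harmonic_log p oo ?x) =
      (fls_X - fls_const (harmonic p)) * fps_to_fls (fps_exp (of_nat p))
      + (\<Sum>k\<le>p. of_nat (p choose k) * fls_const (harmonic k) * E ^ (p - k))"
    unfolding harmonic_log_compose
    by (simp add: fps_to_fls_sum fls_times_fps_to_fls fps_to_fls_power E_def)
  ultimately have "E ^ (p + 1) * fps_to_fls (beta_fps p oo ?x) =
      of_nat (p + 1) * ((fls_X - fls_const (harmonic p)) * fps_to_fls (fps_exp (of_nat p))
      + (\<Sum>k\<le>p. of_nat (p choose k) * fls_const (harmonic k) * E ^ (p - k)))"
    by (simp only: fls_times_fps_to_fls fps_to_fls_power x fps_to_fls_of_nat)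
  then have "fps_to_fls (beta_fps p oo ?x) =
      of_nat (p + 1) * (fls_X - fls_const (harmonic p)) * fps_to_fls (fps_exp (of_nat p)) / E ^ (p + 1)
      + of_nat (p + 1) * ((\<Sum>k\<le>p. of_nat (p choose k) * fls_const (harmonic k) * E ^ (p - k)) / E ^ (p + 1))"
    using E by (simp add: nonzero_eq_divide_eq mult.commute distrib_left mult.assoc
        flip: add_divide_distrib del: of_nat_add)
  also have "(\<Sum>k\<le>p. of_nat (p choose k) * fls_const (harmonic k) * E ^ (p - k)) / E ^ (p + 1)
      = (\<Sum>k\<le>p. of_nat (p choose k) * (fls_const (harmonic k) / E ^ (k + 1)))"
    unfolding sum_divide_distrib
  proof (rule sum.cong)
    fix k assume "k \<in> {..p}"
    \<comment> \<open>Here \<open>k \<le> p\<close> makes the natural subtraction exact.\<close>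
    then have "E ^ (p + 1) = E ^ (p - k) * E ^ (k + 1)"
      by (simp flip: power_add)
    then show "of_nat (p choose k) * fls_const (harmonic k) * E ^ (p - k) / E ^ (p + 1)
        = of_nat (p choose k) * (fls_const (harmonic k) / E ^ (k + 1))"
      using E by simp
  qed simp
  \<comment> \<open>The summand at \<open>k = 0\<close> drops out because H_0 = 0.\<close>
  also have "\<dots> = (\<Sum>k = 1..p. of_nat (p choose k) * (fls_const (harmonic k) / E ^ (k + 1)))"
    by (rule sum.mono_neutral_right) (auto simp: harmonic_def not_le)
  finally show ?thesis
    unfolding p_bernoulli_egf E_def .
qed

end
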